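(* Let $n,m\in\mathbb{N}$, let $x_0,x_1,\ldots,x_m\in\mathbb{R}^n$, and set $X=[x_0\ \cdots\ x_{m-1}]\in\mathbb{R}^{n\times m}$, $Z=[x_1\ \cdots\ x_m]\in\mathbb{R}^{n\times m}$ and $A_{\mathrm{DMD}}=ZX^\dagger\in\mathbb{R}^{n\times n}$. Let $T\in\mathbb{R}^{n\times n}$ be nonsingular, set $\tilde X=TX$, $\tilde Z=TZ$, and let $\tilde A_{\mathrm{DMD}}=\tilde Z\tilde X^\dagger$ be the DMD matrix of the transformed data. Then $$A_{\mathrm{DMD}}X=T^{-1}\tilde A_{\mathrm{DMD}}TX=T^{-1}\tilde A_{\mathrm{DMD}}\tilde X.$$ Moreover, if $T$ is unitary or $\operatorname{rank}(X)=n$, then $$A_{\mathrm{DMD}}=T^{-1}\tilde A_{\mathrm{DMD}}T.$$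
   Context: For a real matrix $M$, $M^\dagger$ denotes its Moore-Penrose pseudoinverse. For data $x_0,\ldots,x_m\in\mathbb{R}^n$ with $X=[x_0\ \cdots\ x_{m-1}]$ and $Z=[x_1\ \cdots\ x_m]$, the matrix $A_{\mathrm{DMD}}:=ZX^\dagger$ is called the DMD (dynamic mode decomposition) matrix of the data. Since $T$ is real, unitary means $T^\top T=I_n$. *)

theory Defs
  imports
    "HOL.Real"
    "Jordan_Normal_Form.Gauss_Jordan_Elimination"
    "Jordan_Normal_Form.DL_Rank"
begin

text \<open>
  The four Penrose conditions for real matrices, together with the format of the pseudoinverse:
  the carrier condition is needed because the dimensions of a matrix are not part of its type.
\<close>

definition is_pseudoinverse :: "real mat \<Rightarrow> real mat \<Rightarrow> bool" where
  "is_pseudoinverse M P \<longleftrightarrow>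
     P \<in> carrier_mat (dim_col M) (dim_row M) \<and>
     M * P * M = M \<and>
     P * M * P = P \<and>
     transpose_mat (M * P) = M * P \<and>
     transpose_mat (P * M) = P * M"

text \<open>
  Every real matrix has exactly one Moore-Penrose pseudoinverse, so the description below is proper.
\<close>

definition pseudoinverse :: "real mat \<Rightarrow> real mat" where
  "pseudoinverse M = (THE P. is_pseudoinverse M P)"

definition dmd_matrix :: "real mat \<Rightarrow> real mat \<Rightarrow> real mat" where
  "dmd_matrix X Z = Z * pseudoinverse X"

text \<open>
  The library's \<^const>\<open>mat_inverse\<close> is option-valued; for a nonsingular matrix it is \<^const>\<open>Some\<close>
  of the two-sided inverse, and no use is made of the value for singular matrices.
\<close>

abbreviation inverse_mat :: "real mat \<Rightarrow> real mat" where
  "inverse_mat M \<equiv> the (mat_inverse M)"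

end

theory Submission
  imports Defs
begin

text \<open>
  Write \<open>X\<^sup>+\<close> for the pseudoinverse.  After cancelling \<open>T\<^sup>-\<^sup>1 T\<close>, the matrix
  \<open>T\<^sup>-\<^sup>1 A' T\<close> equals \<open>Z (T X)\<^sup>+ T\<close>, so everything is a comparison of \<open>(T X)\<^sup>+ T\<close> with \<open>X\<^sup>+\<close>.

  Both \<open>X\<^sup>+ X\<close> and \<open>(T X)\<^sup>+ T X\<close> are orthogonal projectors along the common kernel of \<open>X\<close> and \<open>T X\<close>,
  so they coincide (\<open>pseudoinverse_projector_left_mult\<close>).  Multiplying by \<open>Z\<close> on the left gives
  the first claim.  If \<open>X\<close> has rank \<open>n\<close>, then \<open>X X\<^sup>+ = 1\<close>, and multiplying the same identity by
  \<open>X\<^sup>+\<close> on the right gives \<open>(T X)\<^sup>+ T = X\<^sup>+\<close>.  If \<open>T\<^sup>T T = 1\<close>, then \<open>X\<^sup>+ T\<^sup>T\<close> satisfies the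
  Penrose conditions for \<open>T X\<close>, and again \<open>(T X)\<^sup>+ T = X\<^sup>+ T\<^sup>T T = X\<^sup>+\<close>.

  The pseudoinverse is a definite description, so none of this says anything before its existence
  and uniqueness are known.  Uniqueness is once more the uniqueness of orthogonal projectors.
  Existence is built up in three stages: Gauss-Jordan elimination gives, for every matrix \<open>M\<close>, some
  \<open>G\<close> with \<open>M G M = M\<close>; applied to the Gram matrix \<open>M\<^sup>T M\<close> it gives a \<open>B\<close> for which moreover
  \<open>M B\<close> is symmetric; and such inverses of \<open>M\<close> and of \<open>M\<^sup>T\<close> combine to the pseudoinverse.
\<close>

section \<open>Matrix algebra with dimension conditions\<close>

text \<open>
  In these forms of the library rules all side conditions are equations between dimensions, without
  free variables for the formats, so that the simplifier can discharge them when it rewrites.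
\<close>

lemma mult_mat_assoc_dim:
  fixes A B C :: "'a :: semiring_0 mat"
  assumes "dim_col A = dim_row B" "dim_col B = dim_row C"
  shows "A * B * C = A * (B * C)"
  using assms by (intro assoc_mult_mat[of _ "dim_row A" "dim_col A" _ "dim_col B" _ "dim_col C"]) auto

lemma transpose_mult_dim:
  fixes A B :: "'a :: comm_semiring_0 mat"
  assumes "dim_col A = dim_row B"
  shows "transpose_mat (A * B) = transpose_mat B * transpose_mat A"
  using assms by (intro transpose_mult[of _ "dim_row A" "dim_col A" _ "dim_col B"]) auto

text \<open>
  Transposing \<open>E F = E\<close> gives \<open>F E = E\<close>.  The two mixed products say that \<open>E\<close> and \<open>F\<close> have the same
  kernel, so this is the uniqueness of the orthogonal projector along a given kernel.
\<close>

lemma symmetric_projectors_eqI: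
  fixes E F :: "'a :: comm_semiring_0 mat"
  assumes "transpose_mat E = E" "transpose_mat F = F" "E * F = E" "F * E = F"
    and "dim_col E = dim_row F"
  shows "E = F"
proof -
  have "E = transpose_mat (E * F)"
    using assms by simp
  also have "\<dots> = transpose_mat F * transpose_mat E"
    using assms(5) by (rule transpose_mult_dim)
  also have "\<dots> = F"
    using assms by simp
  finally show ?thesis .
qed

section \<open>Generalized inverses from Gauss-Jordan elimination\<close>

text \<open>
  The transposed pattern of pivots is a generalized inverse of a reduced row echelon form \<open>R\<close>:
  \<open>R G\<close> picks the pivot columns of \<open>R\<close>, which are unit vectors, so it is the diagonal matrix that
  keeps the nonzero rows.
\<close>

lemma row_echelon_generalized_inverse:
  fixes R :: "'a :: semiring_1 mat"
  assumes R: "R \<in> carrier_mat nr nc" and echelon: "row_echelon_form R"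
  obtains G where "G \<in> carrier_mat nc nr" "R * G * R = R"
proof -
  obtain f where f: "pivot_fun R f nc"
    using echelon R by (auto simp: row_echelon_form_def)
  have dim: "dim_row R = nr"
    using R by simp
  note piv = pivot_funD[OF dim f]
  \<comment> \<open>A zero row \<open>i\<close> has \<open>f i = nc\<close>, which is out of range, and so yields a zero column.\<close>
  define G :: "'a mat" where "G = mat nc nr (\<lambda>(k, i). if k = f i then 1 else 0)"
  have G: "G \<in> carrier_mat nc nr"
    by (simp add: G_def)
  define E where "E = R * G"
  have E: "E \<in> carrier_mat nr nr"
    using R G by (simp add: E_def)
  have E_entry: "E $$ (i, k) = (if i = k \<and> f k < nc then 1 else 0)" if i: "i < nr" and k: "k < nr" for i k
  proof -
    have "E $$ (i, k) = (\<Sum>l = 0..<nc. R $$ (i, l) * (if l = f k then 1 else 0))"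
      using R i k by (simp add: E_def G_def scalar_prod_def)
    also have "\<dots> = (\<Sum>l = 0..<nc. if l = f k then R $$ (i, l) else 0)"
      by (intro sum.cong) auto
    also have "\<dots> = (if f k < nc then R $$ (i, f k) else 0)"
      by simp
    finally show ?thesis
      using piv(4)[OF k] piv(5)[OF k _ i] by auto
  qed
  have "E * R = R"
  proof (rule eq_matI)
    fix i j
    assume "i < dim_row R" "j < dim_col R"
    then have i: "i < nr" and j: "j < nc"
      using R by auto
    have "(E * R) $$ (i, j) = (\<Sum>k = 0..<nr. E $$ (i, k) * R $$ (k, j))"
      using R E i j by (simp add: scalar_prod_def)
    also have "\<dots> = (\<Sum>k = 0..<nr. if k = i then (if f i < nc then R $$ (i, j) else 0) else 0)"
      using i by (intro sum.cong) (auto simp: E_entry)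
    also have "\<dots> = (if f i < nc then R $$ (i, j) else 0)"
      using i by simp
    also have "\<dots> = R $$ (i, j)"
      using piv(1)[OF i] piv(2)[OF i, of j] j by auto
    finally show "(E * R) $$ (i, j) = R $$ (i, j)" .
  qed (use R E in auto)
  with G show thesis
    by (intro that) (simp_all add: E_def)
qed

lemma generalized_inverse_exists:
  fixes M :: "'a :: field mat"
  assumes M: "M \<in> carrier_mat nr nc"
  obtains G where "G \<in> carrier_mat nc nr" "M * G * M = M"
proof -
  obtain P Q R where R: "R \<in> carrier_mat nr nc" "row_echelon_form R" "R = P * M"
    and PQ: "P \<in> carrier_mat nr nr" "Q \<in> carrier_mat nr nr" "Q * P = 1\<^sub>m nr"
    using gauss_jordan_single[OF M refl] by blast
  obtain H where H: "H \<in> carrier_mat nc nr" "R * H * R = R"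
    using row_echelon_generalized_inverse[OF R(1,2)] by blast
  have QR: "Q * R = M"
    using PQ M R(3) by (simp flip: mult_mat_assoc_dim)
  have "M * (H * P) * M = M * H * R"
    using M H PQ R(3) by (simp add: mult_mat_assoc_dim)
  also have "\<dots> = Q * (R * H * R)"
    using H PQ R(1) unfolding QR[symmetric] by (simp add: mult_mat_assoc_dim)
  also have "\<dots> = M"
    using H QR by simp
  finally show thesis
    using that[of "H * P"] H PQ by auto
qed

section \<open>Existence and uniqueness of the pseudoinverse\<close>

text \<open>The diagonal of \<open>N\<^sup>T N\<close> consists of the squared lengths of the columns of \<open>N\<close>.\<close>

lemma gram_mat_eq_0D:
  fixes N :: "real mat"
  assumes N: "N \<in> carrier_mat nr nc" and zero: "transpose_mat N * N = 0\<^sub>m nc nc"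
  shows "N = 0\<^sub>m nr nc"
proof (rule eq_matI)
  fix i j
  assume "i < dim_row (0\<^sub>m nr nc :: real mat)" "j < dim_col (0\<^sub>m nr nc :: real mat)"
  then have i: "i < nr" and j: "j < nc"
    by auto
  have "(\<Sum>k = 0..<nr. N $$ (k, j) * N $$ (k, j)) = (transpose_mat N * N) $$ (j, j)"
    using N j by (simp add: scalar_prod_def)
  also have "\<dots> = 0"
    using zero j by simp
  finally have "N $$ (i, j) * N $$ (i, j) = 0"
    using i by (simp add: sum_nonneg_eq_0_iff)
  then show "N $$ (i, j) = 0\<^sub>m nr nc $$ (i, j)"
    using i j by simp
qed (use N in auto)

text \<open>The Gram matrix of \<open>M\<close> has the same kernel as \<open>M\<close>, so it can be replaced by \<open>M\<close> in equations.\<close>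

lemma gram_mat_cancel:
  fixes M Y Y' :: "real mat"
  assumes M: "M \<in> carrier_mat nr nc" and Y: "Y \<in> carrier_mat nc k" "Y' \<in> carrier_mat nc k"
    and eq: "transpose_mat M * (M * Y) = transpose_mat M * (M * Y')"
  shows "M * Y = M * Y'"
proof -
  have MY: "M * Y \<in> carrier_mat nr k" "M * Y' \<in> carrier_mat nr k"
    using M Y by auto
  let ?N = "M * Y - M * Y'"
  have N: "?N \<in> carrier_mat nr k"
    by (rule minus_carrier_mat[OF MY(2)])
  have D: "Y - Y' \<in> carrier_mat nc k"
    by (rule minus_carrier_mat[OF Y(2)])
  have N_eq: "?N = M * (Y - Y')"
    using M Y by (simp add: mult_minus_distrib_mat)
  have "transpose_mat M * ?N = transpose_mat M * (M * Y) - transpose_mat M * (M * Y')"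
    using M MY by (intro mult_minus_distrib_mat) auto
  also have "\<dots> = 0\<^sub>m nc k"
    unfolding eq using M MY by (intro eq_matI) auto
  finally have MN: "transpose_mat M * ?N = 0\<^sub>m nc k" .
  have "transpose_mat ?N * ?N = transpose_mat (Y - Y') * (transpose_mat M * ?N)"
    unfolding N_eq using M Y by (simp add: transpose_mult_dim mult_mat_assoc_dim)
  also have "\<dots> = 0\<^sub>m k k"
    unfolding MN using D by (simp add: right_mult_zero_mat[of _ k nc])
  finally have zero: "?N = 0\<^sub>m nr k"
    using gram_mat_eq_0D[OF N] by simp
  have entry: "(M * Y) $$ (i, j) = (M * Y') $$ (i, j)" if "i < nr" "j < k" for i j
    using arg_cong[OF zero, of "\<lambda>N. N $$ (i, j)"] M Y that by (simp del: index_mult_mat(1))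
  show ?thesis
    using M Y by (intro eq_matI) (auto intro!: entry simp del: index_mult_mat(1))
qed

text \<open>
  The product \<open>B b\<close> solves the normal equations of \<open>M v = b\<close>; accordingly \<open>B = G M\<^sup>T\<close> for a
  generalized inverse \<open>G\<close> of the Gram matrix.  Although \<open>G\<close> need not be symmetric, its transpose is
  again a generalized inverse of the Gram matrix, and this makes \<open>M G M\<^sup>T\<close> symmetric.
\<close>

lemma least_squares_inverse_exists:
  fixes M :: "real mat"
  assumes M: "M \<in> carrier_mat nr nc"
  obtains B where "B \<in> carrier_mat nc nr" "M * B * M = M" "transpose_mat (M * B) = M * B"
proof -
  let ?Mt = "transpose_mat M"
  obtain G where G: "G \<in> carrier_mat nc nc" "(?Mt * M) * G * (?Mt * M) = ?Mt * M"
    using generalized_inverse_exists[of "?Mt * M" nc nc] M by auto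
  let ?Gt = "transpose_mat G"
  have cancel: "M * (H * (?Mt * M)) = M"
    if H: "H \<in> carrier_mat nc nc" "(?Mt * M) * H * (?Mt * M) = ?Mt * M" for H
  proof -
    have "?Mt * (M * (H * (?Mt * M))) = ?Mt * (M * 1\<^sub>m nc)"
      using M H by (simp add: mult_mat_assoc_dim)
    then have "M * (H * (?Mt * M)) = M * 1\<^sub>m nc"
      using M H(1) by (intro gram_mat_cancel[OF M, where k = nc]) auto
    then show ?thesis
      using M by simp
  qed
  have "transpose_mat ((?Mt * M) * G * (?Mt * M)) = transpose_mat (?Mt * M)"
    using G(2) by simp
  then have "(?Mt * M) * ?Gt * (?Mt * M) = ?Mt * M"
    using M G(1) by (simp add: transpose_mult_dim mult_mat_assoc_dim)
  with G(1) have MGt: "M * (?Gt * (?Mt * M)) = M"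
    by (intro cancel) auto
  have "transpose_mat (M * (?Gt * (?Mt * M))) = ?Mt"
    using MGt by simp
  then have MtMG: "?Mt * (M * (G * ?Mt)) = ?Mt"
    using M G(1) by (simp add: transpose_mult_dim mult_mat_assoc_dim)
  have "M * (G * ?Mt) = M * (?Gt * (?Mt * M)) * (G * ?Mt)"
    by (simp only: MGt)
  also have "\<dots> = M * (?Gt * (?Mt * (M * (G * ?Mt))))"
    using M G(1) by (simp add: mult_mat_assoc_dim)
  finally have "M * (G * ?Mt) = M * (?Gt * ?Mt)"
    by (simp only: MtMG)
  then have "transpose_mat (M * (G * ?Mt)) = M * (G * ?Mt)"
    using M G(1) by (simp add: transpose_mult_dim mult_mat_assoc_dim)
  moreover have "M * (G * ?Mt) * M = M"
    using cancel[OF G] M G(1) by (simp add: mult_mat_assoc_dim)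
  moreover have "G * ?Mt \<in> carrier_mat nc nr"
    using M G(1) by auto
  ultimately show thesis
    using that by blast
qed

text \<open>
  A least-squares inverse \<open>B\<close> of \<open>M\<close> and the transpose \<open>D\<close> of one of \<open>M\<^sup>T\<close> each satisfy one of the two
  symmetry conditions; \<open>D M B\<close> inherits both, because \<open>M (D M B) = M B\<close> and \<open>(D M B) M = D M\<close>.
\<close>

lemma is_pseudoinverse_exists: "\<exists>P. is_pseudoinverse M P"
proof -
  define nr nc where "nr = dim_row M" and "nc = dim_col M"
  have M: "M \<in> carrier_mat nr nc" "transpose_mat M \<in> carrier_mat nc nr"
    by (auto simp: nr_def nc_def)
  obtain B where B: "B \<in> carrier_mat nc nr" "M * B * M = M" "transpose_mat (M * B) = M * B"
    using least_squares_inverse_exists[OF M(1)] by blast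
  obtain C where C: "C \<in> carrier_mat nr nc" "transpose_mat M * C * transpose_mat M = transpose_mat M"
      "transpose_mat (transpose_mat M * C) = transpose_mat M * C"
    using least_squares_inverse_exists[OF M(2)] by blast
  define D where "D = transpose_mat C"
  have D: "D \<in> carrier_mat nc nr"
    using C(1) by (simp add: D_def)
  have "transpose_mat (transpose_mat M * C * transpose_mat M) = M"
    using C(2) by simp
  then have MDM: "M * (D * M) = M"
    using M C(1) by (simp add: D_def transpose_mult_dim)
  have DM: "transpose_mat (D * M) = D * M"
    using C M by (simp add: D_def transpose_mult_dim)
  have MBM: "M * (B * M) = M"
    using B M by (simp add: mult_mat_assoc_dim)
  have MP: "M * (D * (M * B)) = M * B"
  proof -
    have "M * (D * (M * B)) = M * (D * M) * B"
      using M(1) B(1) D by (simp add: mult_mat_assoc_dim)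
    then show ?thesis
      by (simp only: MDM)
  qed
  have PM: "D * (M * B) * M = D * M"
    using M(1) B(1) D by (simp add: mult_mat_assoc_dim MBM)
  have "is_pseudoinverse M (D * (M * B))"
    unfolding is_pseudoinverse_def PM MP
  proof (intro conjI)
    show "D * (M * B) \<in> carrier_mat (dim_col M) (dim_row M)"
      using M(1) B(1) D by simp
    show "D * M * (D * (M * B)) = D * (M * B)"
      using M(1) B(1) D by (simp add: mult_mat_assoc_dim MP)
  qed (use B DM in auto)
  then show ?thesis ..
qed

text \<open>
  The two pseudoinverses define the same projectors \<open>P M\<close> and \<open>M P\<close>, and \<open>P = P M P\<close> recovers a
  pseudoinverse from its projectors.
\<close>

lemma is_pseudoinverse_unique:
  assumes P: "is_pseudoinverse M P" and Q: "is_pseudoinverse M Q"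
  shows "P = Q"
proof -
  have dims: "dim_row P = dim_col M" "dim_col P = dim_row M" "dim_row Q = dim_col M" "dim_col Q = dim_row M"
    using P Q by (auto simp: is_pseudoinverse_def)
  have pen: "M * P * M = M" "P * M * P = P" "M * Q * M = M" "Q * M * Q = Q"
    "transpose_mat (M * P) = M * P" "transpose_mat (P * M) = P * M"
    "transpose_mat (M * Q) = M * Q" "transpose_mat (Q * M) = Q * M"
    using P Q by (simp_all add: is_pseudoinverse_def)
  have pen': "M * (P * M) = M" "M * (Q * M) = M"
    using pen(1,3) dims by (simp_all add: mult_mat_assoc_dim)
  have "P * M = Q * M"
  proof (rule symmetric_projectors_eqI)
    show "P * M * (Q * M) = P * M" "Q * M * (P * M) = Q * M"
      using dims by (simp_all add: mult_mat_assoc_dim pen')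
  qed (use pen(6,8) dims in auto)
  moreover have "M * Q = M * P"
  proof (rule symmetric_projectors_eqI)
    show "M * Q * (M * P) = M * Q"
    proof -
      have "M * Q * (M * P) = transpose_mat (M * P * (M * Q))"
        using pen(5,7) dims by (simp add: transpose_mult_dim[of "M * P" "M * Q"])
      also have "M * P * (M * Q) = M * P * M * Q"
        using dims by (simp add: mult_mat_assoc_dim)
      finally show ?thesis
        by (simp add: pen)
    qed
    show "M * P * (M * Q) = M * P"
    proof -
      have "M * P * (M * Q) = transpose_mat (M * Q * (M * P))"
        using pen(5,7) dims by (simp add: transpose_mult_dim[of "M * Q" "M * P"])
      also have "M * Q * (M * P) = M * Q * M * P"
        using dims by (simp add: mult_mat_assoc_dim)
      finally show ?thesis
        by (simp add: pen)
    qed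
  qed (use pen(5,7) dims in auto)
  ultimately have "P * M * P = Q * M * Q"
    using dims by (simp add: mult_mat_assoc_dim)
  then show ?thesis
    by (simp add: pen)
qed

lemma is_pseudoinverse_pseudoinverse: "is_pseudoinverse M (pseudoinverse M)"
  unfolding pseudoinverse_def
  using is_pseudoinverse_exists[of M] is_pseudoinverse_unique[of M] by (metis theI)

lemma pseudoinverse_eqI: "is_pseudoinverse M P \<Longrightarrow> pseudoinverse M = P"
  using is_pseudoinverse_pseudoinverse is_pseudoinverse_unique by blast

lemma pseudoinverse_carrier:
  "M \<in> carrier_mat nr nc \<Longrightarrow> pseudoinverse M \<in> carrier_mat nc nr"
  using is_pseudoinverse_pseudoinverse[of M] by (auto simp: is_pseudoinverse_def)

lemma pseudoinverse_cancel:
  "M * pseudoinverse M * M = M" "pseudoinverse M * M * pseudoinverse M = pseudoinverse M"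
  using is_pseudoinverse_pseudoinverse[of M] by (auto simp: is_pseudoinverse_def)

lemma pseudoinverse_symmetric:
  "transpose_mat (M * pseudoinverse M) = M * pseudoinverse M"
  "transpose_mat (pseudoinverse M * M) = pseudoinverse M * M"
  using is_pseudoinverse_pseudoinverse[of M] by (auto simp: is_pseudoinverse_def)

section \<open>Pseudoinverses under multiplication from the left\<close>

text \<open>
  A left invertible factor \<open>T\<close> does not change the kernel, and \<open>M\<^sup>+ M\<close> is the orthogonal projector
  along the kernel of \<open>M\<close>.
\<close>

lemma pseudoinverse_projector_left_mult:
  assumes M: "M \<in> carrier_mat n m" and T: "T \<in> carrier_mat k n" and S: "S \<in> carrier_mat n k"
    and ST: "S * T = 1\<^sub>m n"
  shows "pseudoinverse (T * M) * (T * M) = pseudoinverse M * M"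
proof -
  define P where "P = pseudoinverse M"
  define Q where "Q = pseudoinverse (T * M)"
  have P: "P \<in> carrier_mat m n"
    unfolding P_def by (rule pseudoinverse_carrier[OF M])
  have Q: "Q \<in> carrier_mat m k"
    unfolding Q_def by (rule pseudoinverse_carrier) (use T M in auto)
  have MPM: "M * (P * M) = M"
    using pseudoinverse_cancel(1)[of M] M P by (simp add: P_def mult_mat_assoc_dim)
  have TMQTM: "T * M * Q * (T * M) = T * M"
    unfolding Q_def by (rule pseudoinverse_cancel)
  have "M * (Q * (T * M)) = S * T * M * (Q * (T * M))"
    using M by (simp add: ST)
  also have "\<dots> = S * (T * M * Q * (T * M))"
    using M T S Q by (simp add: mult_mat_assoc_dim)
  also have "\<dots> = S * T * M"
    using TMQTM M T S by (simp add: mult_mat_assoc_dim)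
  finally have MQTM: "M * (Q * (T * M)) = M"
    using M by (simp add: ST)
  have "Q * (T * M) = P * M"
  proof (rule symmetric_projectors_eqI)
    show "transpose_mat (Q * (T * M)) = Q * (T * M)" "transpose_mat (P * M) = P * M"
      by (simp_all add: P_def Q_def pseudoinverse_symmetric)
    show "Q * (T * M) * (P * M) = Q * (T * M)"
      using M T P Q by (simp add: mult_mat_assoc_dim MPM)
    show "P * M * (Q * (T * M)) = P * M"
      using M T P Q by (simp add: mult_mat_assoc_dim MQTM)
  qed (use M P in auto)
  then show ?thesis
    by (simp add: P_def Q_def)
qed

text \<open>
  In the Penrose products \<open>T\<^sup>T T\<close> cancels: \<open>(M\<^sup>+ T\<^sup>T) (T M) = M\<^sup>+ M\<close>, while \<open>(T M) (M\<^sup>+ T\<^sup>T)\<close> is the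
  symmetric matrix \<open>T (M M\<^sup>+) T\<^sup>T\<close>.  For a merely nonsingular \<open>T\<close> the candidate \<open>M\<^sup>+ T\<^sup>-\<^sup>1\<close>
  would lead to \<open>T (M M\<^sup>+) T\<^sup>-\<^sup>1\<close>, which is not symmetric in general.
\<close>

lemma pseudoinverse_isometry_mult:
  assumes M: "M \<in> carrier_mat n m" and T: "T \<in> carrier_mat k n"
    and TT: "transpose_mat T * T = 1\<^sub>m n"
  shows "pseudoinverse (T * M) = pseudoinverse M * transpose_mat T"
proof (rule pseudoinverse_eqI)
  define P where "P = pseudoinverse M"
  have P: "P \<in> carrier_mat m n"
    unfolding P_def by (rule pseudoinverse_carrier[OF M])
  have MPM: "M * (P * M) = M" and PMP: "P * (M * P) = P"
    using pseudoinverse_cancel[of M] M P by (simp_all add: P_def mult_mat_assoc_dim)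
  have TTN: "transpose_mat T * (T * N) = N" if "N \<in> carrier_mat n l" for N l
    using T that TT by (simp flip: mult_mat_assoc_dim)
  have right: "T * M * (P * transpose_mat T) = T * ((M * P) * transpose_mat T)"
    using M T P by (simp add: mult_mat_assoc_dim)
  have left: "P * transpose_mat T * (T * M) = P * M"
    using M T P by (simp add: mult_mat_assoc_dim TTN[OF M])
  show "is_pseudoinverse (T * M) (pseudoinverse M * transpose_mat T)"
    unfolding is_pseudoinverse_def P_def[symmetric]
  proof (intro conjI)
    show "P * transpose_mat T \<in> carrier_mat (dim_col (T * M)) (dim_row (T * M))"
      using M T P by auto
    show "T * M * (P * transpose_mat T) * (T * M) = T * M"
      using M T P by (simp add: mult_mat_assoc_dim TTN[OF M] MPM)
    show "P * transpose_mat T * (T * M) * (P * transpose_mat T) = P * transpose_mat T"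
    proof -
      have "P * M * (P * transpose_mat T) = P * (M * P) * transpose_mat T"
        using M T P by (simp add: mult_mat_assoc_dim)
      then show ?thesis
        by (simp only: left PMP)
    qed
    have "transpose_mat (T * (W * transpose_mat T)) = T * (W * transpose_mat T)"
      if "W \<in> carrier_mat n n" "transpose_mat W = W" for W
      using T that by (simp add: transpose_mult_dim mult_mat_assoc_dim)
    from this[of "M * P"]
    show "transpose_mat (T * M * (P * transpose_mat T)) = T * M * (P * transpose_mat T)"
      unfolding right using M P pseudoinverse_symmetric(1)[of M] by (simp add: P_def)
    show "transpose_mat (P * transpose_mat T * (T * M)) = P * transpose_mat T * (T * M)"
      unfolding left by (simp add: P_def pseudoinverse_symmetric)
  qed
qed

text \<open>
  Full row rank means that every \<open>v\<close> has the form \<open>M w\<close>, and \<open>M G\<close> fixes all such vectors.  That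
  the columns span follows by counting: a maximal independent set of them has \<open>n\<close> elements.
\<close>

lemma (in vec_space) full_row_rank_right_inverse:
  assumes M: "M \<in> carrier_mat n m" and rank: "rank M = n"
    and G: "G \<in> carrier_mat m n" and MGM: "M * G * M = M"
  shows "M * G = 1\<^sub>m n"
proof -
  have cols: "set (cols M) \<subseteq> carrier_vec n"
    using M cols_dim by blast
  have "\<exists>B. finite B \<and> maximal B (\<lambda>B. B \<subseteq> set (cols M) \<and> lin_indpt B) \<and> {} \<subseteq> B"
    by (rule maximal_exists_superset[where S = "set (cols M)"]) (auto simp: lin_dep_def)
  then obtain B where B: "finite B" "maximal B (\<lambda>B. B \<subseteq> set (cols M) \<and> lin_indpt B)"
    by blast
  then have sub: "B \<subseteq> set (cols M)" and indpt: "lin_indpt B"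
    by (auto simp: maximal_def)
  have "card B = n"
    using rank_card_indpt[OF M B(2)] rank by simp
  then have "basis B"
    using B(1) sub indpt cols by (intro dim_li_is_basis) (auto simp: dim_is_n)
  then have "carrier_vec n = span B"
    by (simp add: basis_def)
  also have "\<dots> \<subseteq> col_space M"
    unfolding col_space_def by (rule span_is_monotone[OF sub])
  finally have surj: "\<exists>w \<in> carrier_vec m. M *\<^sub>v w = v" if "v \<in> carrier_vec n" for v
    using that M by (auto simp: col_space_eq[OF M])
  have fixed: "(M * G) *\<^sub>v v = v" if v: "v \<in> carrier_vec n" for v
  proof -
    obtain w where w: "w \<in> carrier_vec m" "M *\<^sub>v w = v"
      using surj[OF v] by blast
    have "(M * G * M) *\<^sub>v w = (M * G) *\<^sub>v (M *\<^sub>v w)"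
      using M G w by (intro assoc_mult_mat_vec) auto
    then show ?thesis
      using w by (simp add: MGM)
  qed
  have MG: "M * G \<in> carrier_mat n n"
    using M G by auto
  have "col (M * G) j = col (1\<^sub>m n) j" if "j < n" for j
    using fixed[of "unit_vec n j"] col_mult2[OF MG one_carrier_mat that, unfolded right_mult_one_mat[OF MG]] that
    by simp
  then show ?thesis
    using MG by (intro mat_col_eqI) auto
qed

text \<open>
  Since \<open>M M\<^sup>+ = 1\<close> here, \<open>(T M)\<^sup>+ T = (T M)\<^sup>+ T M M\<^sup>+\<close>, and the projector identity turns this into
  \<open>M\<^sup>+ M M\<^sup>+\<close>.
\<close>

lemma pseudoinverse_full_row_rank_left_mult:
  assumes M: "M \<in> carrier_mat n m" and T: "T \<in> carrier_mat k n" and S: "S \<in> carrier_mat n k"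
    and ST: "S * T = 1\<^sub>m n" and rank: "vec_space.rank n M = n"
  shows "pseudoinverse (T * M) * T = pseudoinverse M"
proof -
  define P where "P = pseudoinverse M"
  define Q where "Q = pseudoinverse (T * M)"
  have P: "P \<in> carrier_mat m n"
    unfolding P_def by (rule pseudoinverse_carrier[OF M])
  have Q: "Q \<in> carrier_mat m k"
    unfolding Q_def by (rule pseudoinverse_carrier) (use T M in auto)
  have MP: "M * P = 1\<^sub>m n"
    using vec_space.full_row_rank_right_inverse[OF M rank P] pseudoinverse_cancel(1)[of M]
    by (simp add: P_def)
  have "Q * T = Q * (T * M) * P"
    using M T P Q by (simp add: mult_mat_assoc_dim MP)
  also have "Q * (T * M) = P * M"
    unfolding P_def Q_def by (rule pseudoinverse_projector_left_mult[OF M T S ST])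
  also have "P * M * P = P"
    unfolding P_def by (rule pseudoinverse_cancel)
  finally show ?thesis
    by (simp add: P_def Q_def)
qed

section \<open>Change of coordinates for the DMD matrix\<close>

lemma inverse_mat_invertible:
  fixes T :: "real mat"
  assumes T: "T \<in> carrier_mat n n" and inv: "invertible_mat T"
  shows "inverse_mat T \<in> carrier_mat n n" "inverse_mat T * T = 1\<^sub>m n"
proof -
  obtain B where B: "T * B = 1\<^sub>m n" "B * T = 1\<^sub>m (dim_row B)"
    using inv T by (auto simp: invertible_mat_def inverts_mat_def)
  have "dim_col B = n" "dim_row B = n"
    using arg_cong[OF B(1), of dim_col] arg_cong[OF B(2), of dim_col] T by auto
  with B T have "T \<in> Units (ring_mat TYPE(real) n ())"
    by (auto simp: Units_def ring_mat_def intro!: bexI[of _ B])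
  then obtain C where "mat_inverse T = Some C"
    using mat_inverse(1)[OF T, where b = "()"] by (cases "mat_inverse T") auto
  then show "inverse_mat T \<in> carrier_mat n n" "inverse_mat T * T = 1\<^sub>m n"
    using mat_inverse(2)[OF T] by auto
qed

theorem theorem3p2:
  fixes n m :: nat
    and x :: "nat \<Rightarrow> real vec"
    and T X Z A X' Z' A' :: "real mat"
  assumes x_dim: "\<And>i. i \<le> m \<Longrightarrow> x i \<in> carrier_vec n"
    and X: "X = mat_of_cols n (map x [0..<m])"
    and Z: "Z = mat_of_cols n (map x [1..<m + 1])"
    and A: "A = dmd_matrix X Z"
    and T_dim: "T \<in> carrier_mat n n"
    and T_nonsingular: "invertible_mat T"
    and X': "X' = T * X"
    and Z': "Z' = T * Z"
    and A': "A' = dmd_matrix X' Z'"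
  shows "A * X = inverse_mat T * A' * T * X
       \<and> inverse_mat T * A' * T * X = inverse_mat T * A' * X'
       \<and> (transpose_mat T * T = 1\<^sub>m n \<or> vec_space.rank n X = n
            \<longrightarrow> A = inverse_mat T * A' * T)"
proof -
  define S where "S = inverse_mat T"
  have S: "S \<in> carrier_mat n n" "S * T = 1\<^sub>m n"
    using inverse_mat_invertible[OF T_dim T_nonsingular] by (simp_all add: S_def)
  have X_dim: "X \<in> carrier_mat n m" and Z_dim: "Z \<in> carrier_mat n m"
    using mat_of_cols_carrier(1)[of n "map x [0..<m]"] mat_of_cols_carrier(1)[of n "map x [1..<m + 1]"]
    by (simp_all add: X Z del: upt_Suc)
  define P where "P = pseudoinverse X"
  define Q where "Q = pseudoinverse (T * X)"
  have P: "P \<in> carrier_mat m n"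
    unfolding P_def by (rule pseudoinverse_carrier[OF X_dim])
  have Q: "Q \<in> carrier_mat m n"
    unfolding Q_def by (rule pseudoinverse_carrier) (use T_dim X_dim in auto)
  have A_eq: "A = Z * P" and A'_eq: "A' = T * Z * Q"
    by (simp_all add: A A' X' Z' dmd_matrix_def P_def Q_def)
  have "S * A' = S * T * (Z * Q)"
    using S(1) T_dim Z_dim Q by (simp add: A'_eq mult_mat_assoc_dim)
  also have "\<dots> = Z * Q"
    using S(2) Z_dim Q by simp
  finally have SA': "S * A' = Z * Q" .
  have assoc: "S * A' * T * X = S * A' * X'"
    unfolding SA' X' using T_dim X_dim Z_dim Q by (simp add: mult_mat_assoc_dim)
  have "A * X = Z * (P * X)"
    using X_dim Z_dim P by (simp add: A_eq mult_mat_assoc_dim)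
  also have "P * X = Q * X'"
    unfolding P_def Q_def X'
    by (rule pseudoinverse_projector_left_mult[OF X_dim T_dim S, symmetric])
  also have "Z * (Q * X') = S * A' * X'"
    unfolding SA' X' using T_dim X_dim Z_dim Q by (simp add: mult_mat_assoc_dim)
  finally have on_data: "A * X = S * A' * X'" .
  have "A = S * A' * T" if "transpose_mat T * T = 1\<^sub>m n \<or> vec_space.rank n X = n"
  proof -
    have "Q * T = P"
      using that
    proof
      assume TT: "transpose_mat T * T = 1\<^sub>m n"
      have "Q = P * transpose_mat T"
        unfolding P_def Q_def by (rule pseudoinverse_isometry_mult[OF X_dim T_dim TT])
      then show ?thesis
        using T_dim P TT by (simp add: mult_mat_assoc_dim)
    next
      assume "vec_space.rank n X = n"
      then show ?thesis
        unfolding P_def Q_def by (rule pseudoinverse_full_row_rank_left_mult[OF X_dim T_dim S])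
    qed
    moreover have "S * A' * T = Z * (Q * T)"
      unfolding SA' using T_dim Z_dim Q by (simp add: mult_mat_assoc_dim)
    ultimately show ?thesis
      by (simp add: A_eq)
  qed
  with on_data assoc show ?thesis
    by (simp add: S_def)
qed

end
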